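(* Let $r$ be a positive integer and let $p$ be a prime with $p>2r+1$. Then $$\sum_{k=0}^{p-1} k^r\left(k+\frac{1}{p+1}\right)^r\cdot \frac{\left(\frac{1}{p+1}\right)_k^{\,p+1}}{(k!)^{p+1}} \equiv 0 \pmod{p^4}.$$
   Context: $(x)_k=x(x+1)\cdots(x+k-1)$ denotes the Pochhammer symbol (with $(x)_0=1$). Congruences between rational numbers are understood in the ring of rationals whose denominators are prime to $p$. *)

theory Defs
  imports "HOL-Number_Theory.Number_Theory"
begin

(* quotient_of x is the reduced fraction of x, with positive denominator. *)
definition p_integral_rats :: "nat \<Rightarrow> rat set" where
  "p_integral_rats p = {x. coprime (snd (quotient_of x)) (int p)}"

(* Congruence in the ring p_integral_rats p: both sides lie in the ring, and their
   difference is a multiple of m by an element of the ring. *)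
definition rat_cong :: "nat \<Rightarrow> rat \<Rightarrow> rat \<Rightarrow> nat \<Rightarrow> bool" where
  "rat_cong p x y m \<longleftrightarrow>
     x \<in> p_integral_rats p \<and> y \<in> p_integral_rats p \<and>
     (\<exists>c \<in> p_integral_rats p. x - y = of_nat m * c)"

end

theory Submission
  imports Defs "HOL-Computational_Algebra.Polynomial"
begin

text \<open>
  Put \<open>t = p / (p + 1)\<close>, so that \<open>1 / (p + 1) = 1 - t\<close> and the quotient of the Pochhammer symbol by
  \<open>k!\<close> is the product of the factors \<open>1 - t / j\<close> for \<open>1 \<le> j \<le> k\<close>.  Modulo \<open>p ^ 4\<close> the \<open>(p + 1)\<close>-st power
  of such a factor is \<open>(1 - p / j) (1 + p ^ 3 / (2 j\<^sup>2))\<close>, so the \<open>k\<close>-th term of the sum becomes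
  \<open>q(k) (-1) ^ k (p - 1 choose k) (1 + p ^ 3 H(k) / 2)\<close> with \<open>q(k) = k ^ r (k + 1 - t) ^ r\<close> and
  \<open>H(k)\<close> the sum of the \<open>1 / j\<^sup>2\<close>.  The main part vanishes exactly, being a \<open>(p - 1)\<close>-st
  finite difference of a polynomial of degree \<open>2 r < p - 1\<close>.  What remains is \<open>p ^ 3 / 2\<close> times a sum
  congruent modulo \<open>p\<close> to that of \<open>k ^ r (k + 1) ^ r H(k)\<close>.  Under \<open>k \<mapsto> p - 1 - k\<close> the weight
  is invariant modulo \<open>p\<close> and \<open>H(k)\<close> becomes \<open>H(p - 1) - H(k)\<close>, so twice this sum is \<open>H(p - 1)\<close>
  times the sum of the weights, which is again \<open>0\<close> modulo \<open>p\<close> by the finite difference argument.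
\<close>

section \<open>The ring of rationals with denominator prime to p\<close>

text \<open>The reduced denominator divides every other denominator of the same number, so any
  fraction with a denominator prime to \<open>p\<close> certifies membership. This frees the closure
  lemmas below from computing reduced fractions.\<close>

lemma p_integral_rats_iff:
  assumes "prime p"
  shows "x \<in> p_integral_rats p \<longleftrightarrow>
    (\<exists>a b. coprime b (int p) \<and> b \<noteq> 0 \<and> x = of_int a / of_int b)"
proof
  assume "x \<in> p_integral_rats p"
  moreover obtain a b where ab: "quotient_of x = (a, b)" by fastforce
  ultimately show "\<exists>a b. coprime b (int p) \<and> b \<noteq> 0 \<and> x = of_int a / of_int b"
    using quotient_of_div[OF ab] quotient_of_denom_pos[OF ab]
    by (auto simp: p_integral_rats_def)
next
  assume "\<exists>a b. coprime b (int p) \<and> b \<noteq> 0 \<and> x = of_int a / of_int b"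
  then obtain a b where *: "coprime b (int p)" "b \<noteq> 0" "x = of_int a / of_int b" by blast
  obtain c d where cd: "quotient_of x = (c, d)" by fastforce
  note d = quotient_of_div[OF cd] quotient_of_denom_pos[OF cd] quotient_of_coprime[OF cd]
  have "of_int (a * d) = (of_int (c * b) :: rat)"
    using * d by (simp add: field_simps)
  then have "a * d = c * b" by (simp only: of_int_eq_iff)
  then have "d dvd b" using d(3) by (metis coprime_commute coprime_dvd_mult_right_iff dvd_triv_right)
  then have "coprime d (int p)" using *(1) by (meson coprime_divisors dvd_refl)
  then show "x \<in> p_integral_rats p" by (simp add: p_integral_rats_def cd)
qed

lemma p_integral_of_int [simp]:
  assumes "prime p" shows "of_int a \<in> p_integral_rats p"
  unfolding p_integral_rats_iff[OF assms] by (intro exI[of _ a] exI[of _ 1]) simp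

lemma p_integral_of_nat [simp]: "prime p \<Longrightarrow> of_nat n \<in> p_integral_rats p"
  using p_integral_of_int[of p "int n"] by simp

lemma p_integral_numeral [simp]: "prime p \<Longrightarrow> numeral n \<in> p_integral_rats p"
  using p_integral_of_nat[of p "numeral n"] by simp

lemma p_integral_0 [simp]: "prime p \<Longrightarrow> 0 \<in> p_integral_rats p"
  using p_integral_of_nat[of p 0] by simp

lemma p_integral_1 [simp]: "prime p \<Longrightarrow> 1 \<in> p_integral_rats p"
  using p_integral_of_nat[of p 1] by simp

lemma p_integral_add [intro]:
  assumes p: "prime p" and xy: "x \<in> p_integral_rats p" "y \<in> p_integral_rats p"
  shows "x + y \<in> p_integral_rats p"
proof -
  obtain a b where 1: "coprime b (int p)" "b \<noteq> 0" "x = of_int a / of_int b"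
    using xy(1) by (auto simp: p_integral_rats_iff[OF p])
  obtain c d where 2: "coprime d (int p)" "d \<noteq> 0" "y = of_int c / of_int d"
    using xy(2) by (auto simp: p_integral_rats_iff[OF p])
  have "x + y = of_int (a * d + c * b) / of_int (b * d)"
    using 1 2 by (simp add: field_simps)
  then show ?thesis unfolding p_integral_rats_iff[OF p] using 1 2
    by (intro exI[of _ "a * d + c * b"] exI[of _ "b * d"]) auto
qed

lemma p_integral_mult [intro]:
  assumes p: "prime p" and xy: "x \<in> p_integral_rats p" "y \<in> p_integral_rats p"
  shows "x * y \<in> p_integral_rats p"
proof -
  obtain a b where 1: "coprime b (int p)" "b \<noteq> 0" "x = of_int a / of_int b"
    using xy(1) by (auto simp: p_integral_rats_iff[OF p])
  obtain c d where 2: "coprime d (int p)" "d \<noteq> 0" "y = of_int c / of_int d"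
    using xy(2) by (auto simp: p_integral_rats_iff[OF p])
  show ?thesis unfolding p_integral_rats_iff[OF p] using 1 2
    by (intro exI[of _ "a * c"] exI[of _ "b * d"]) auto
qed

lemma p_integral_uminus [intro]:
  "prime p \<Longrightarrow> x \<in> p_integral_rats p \<Longrightarrow> - x \<in> p_integral_rats p"
  using p_integral_mult[of p "-1" x] p_integral_of_int[of p "-1"] by simp

lemma p_integral_diff [intro]:
  "prime p \<Longrightarrow> x \<in> p_integral_rats p \<Longrightarrow> y \<in> p_integral_rats p \<Longrightarrow> x - y \<in> p_integral_rats p"
  using p_integral_add[of p x "- y"] p_integral_uminus[of p y] by simp

lemma p_integral_power [intro]:
  "prime p \<Longrightarrow> x \<in> p_integral_rats p \<Longrightarrow> x ^ n \<in> p_integral_rats p"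
  by (induction n) auto

lemma p_integral_sum [intro]:
  "prime p \<Longrightarrow> (\<And>i. i \<in> A \<Longrightarrow> f i \<in> p_integral_rats p) \<Longrightarrow> sum f A \<in> p_integral_rats p"
  by (induction A rule: infinite_finite_induct) auto

lemmas p_integral_intros = p_integral_add p_integral_diff p_integral_mult p_integral_uminus
  p_integral_power p_integral_of_nat p_integral_0 p_integral_1

lemma p_integral_divide:
  assumes p: "prime p" and "x \<in> p_integral_rats p" "coprime n p"
  shows "x / of_nat n \<in> p_integral_rats p"
proof -
  have "n \<noteq> 0" using assms by (metis coprime_0_left_iff not_prime_unit)
  then have "1 / of_nat n \<in> p_integral_rats p"
    unfolding p_integral_rats_iff[OF p] using assms(3)
    by (intro exI[of _ 1] exI[of _ "int n"]) auto
  then show ?thesis using p_integral_mult[OF p assms(2)] by fastforce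
qed

lemma coprime_small:
  assumes "prime p" "0 < j" "j < p" shows "coprime (j::nat) p"
  using assms by (metis coprime_commute nat_dvd_not_less prime_imp_coprime)

lemma p_integral_half:
  assumes "prime p" "p > 2" "x \<in> p_integral_rats p"
  shows "x / 2 \<in> p_integral_rats p"
  using p_integral_divide[of p x 2] coprime_small[of p 2] assms by simp

section \<open>Calculus of congruences in this ring\<close>

lemma rat_congI:
  "x - y = of_nat m * c \<Longrightarrow> c \<in> p_integral_rats p \<Longrightarrow> x \<in> p_integral_rats p \<Longrightarrow>
    y \<in> p_integral_rats p \<Longrightarrow> rat_cong p x y m"
  unfolding rat_cong_def by blast

lemma rat_cong_refl [intro]: "prime p \<Longrightarrow> x \<in> p_integral_rats p \<Longrightarrow> rat_cong p x x m"
  unfolding rat_cong_def by (auto intro!: bexI[of _ 0])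

lemma rat_cong_sym:
  assumes "prime p" "rat_cong p x y m" shows "rat_cong p y x m"
proof -
  obtain c where "c \<in> p_integral_rats p" "x - y = of_nat m * c"
    using assms by (auto simp: rat_cong_def)
  then show ?thesis using assms unfolding rat_cong_def
    by (auto intro!: bexI[of _ "- c"] simp: algebra_simps)
qed

lemma rat_cong_add:
  assumes "prime p" "rat_cong p x y m" "rat_cong p x' y' m"
  shows "rat_cong p (x + x') (y + y') m"
proof -
  obtain c d where cd: "c \<in> p_integral_rats p" "x - y = of_nat m * c"
      "d \<in> p_integral_rats p" "x' - y' = of_nat m * d"
    using assms by (auto simp: rat_cong_def)
  have "x + x' - (y + y') = of_nat m * (c + d)" using cd by (simp add: algebra_simps)
  then show ?thesis using assms cd unfolding rat_cong_def by blast
qed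

lemma rat_cong_trans:
  assumes "prime p" "rat_cong p x y m" "rat_cong p y z m" shows "rat_cong p x z m"
proof -
  obtain c d where cd: "c \<in> p_integral_rats p" "x - y = of_nat m * c"
      "d \<in> p_integral_rats p" "y - z = of_nat m * d"
    using assms by (auto simp: rat_cong_def)
  have "x - z = of_nat m * (c + d)" using cd by (simp add: algebra_simps)
  then show ?thesis using assms cd unfolding rat_cong_def by blast
qed

lemma rat_cong_mult:
  assumes "prime p" "rat_cong p x y m" "rat_cong p x' y' m"
  shows "rat_cong p (x * x') (y * y') m"
proof -
  obtain c d where cd: "c \<in> p_integral_rats p" "x - y = of_nat m * c"
      "d \<in> p_integral_rats p" "x' - y' = of_nat m * d"
    using assms by (auto simp: rat_cong_def)
  have "x * x' - y * y' = (x - y) * x' + y * (x' - y')" by (simp add: algebra_simps)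
  also have "\<dots> = of_nat m * (c * x' + y * d)" unfolding cd by (simp add: algebra_simps)
  finally show ?thesis using assms cd unfolding rat_cong_def by blast
qed

lemma rat_cong_power:
  "prime p \<Longrightarrow> rat_cong p x y m \<Longrightarrow> rat_cong p (x ^ n) (y ^ n) m"
  by (induction n) (auto intro: rat_cong_mult)

lemma rat_cong_sum:
  "prime p \<Longrightarrow> (\<And>i. i \<in> A \<Longrightarrow> rat_cong p (f i) (g i) m) \<Longrightarrow> rat_cong p (sum f A) (sum g A) m"
  by (induction A rule: infinite_finite_induct) (auto intro: rat_cong_add)

text \<open>Scaling enlarges the modulus as well. With \<open>n = p ^ 3\<close> this lifts a
  congruence modulo \<open>p\<close> to one modulo \<open>p ^ 4\<close>.\<close>

lemma rat_cong_scale: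
  assumes "prime p" "rat_cong p x y m"
  shows "rat_cong p (of_nat n * x) (of_nat n * y) (n * m)"
proof -
  obtain c where c: "c \<in> p_integral_rats p" "x - y = of_nat m * c"
    using assms by (auto simp: rat_cong_def)
  have "of_nat n * x - of_nat n * y = of_nat n * (x - y)" by (simp add: algebra_simps)
  also have "\<dots> = of_nat (n * m) * c" unfolding c by simp
  finally show ?thesis using assms c(1) unfolding rat_cong_def
    by (auto intro!: bexI[of _ c])
qed

section \<open>Finite differences of polynomials\<close>

text \<open>Substituting \<open>X + 1\<close> for \<open>X\<close> keeps both the degree and the
  leading coefficient, so the top terms cancel in the difference.\<close>

lemma degree_diff_pcompose_shift:
  fixes q :: "'a::field_char_0 poly"
  assumes "degree q > 0"
  shows "degree (q - pcompose q [:1, 1:]) < degree q"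
proof (cases "q - pcompose q [:1, 1:] = 0")
  case True
  then show ?thesis using assms by simp
next
  case False
  have d: "degree (pcompose q [:1, 1:]) = degree q" by (simp add: degree_pcompose)
  have "lead_coeff (pcompose q [:1, 1:]) = lead_coeff q"
    by (subst lead_coeff_comp) auto
  then have "coeff (q - pcompose q [:1, 1:]) (degree q) = 0" using d by simp
  moreover have "degree (q - pcompose q [:1, 1:]) \<le> degree q"
    using d by (intro degree_diff_le) auto
  ultimately show ?thesis using False by (intro degree_less_if_less_eqI)
qed

text \<open>Pascal's rule turns the sum for \<open>Suc n\<close> and \<open>q\<close> into the sum
  for \<open>n\<close> and the difference \<open>q(X) - q(X + 1)\<close>, whose degree is smaller,
  so induction on \<open>n\<close> applies.\<close>

lemma alternating_binomial_sum_poly: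
  fixes q :: "'a::field_char_0 poly"
  assumes "degree q < n"
  shows "(\<Sum>k\<le>n. (-1) ^ k * of_nat (n choose k) * poly q (of_nat k)) = 0"
  using assms
proof (induction n arbitrary: q)
  case (Suc n)
  let ?d = "q - pcompose q [:1, 1:]"
  have "(\<Sum>k\<le>Suc n. (-1) ^ k * of_nat (Suc n choose k) * poly q (of_nat k)) =
     (\<Sum>k\<le>n. (-1) ^ k * of_nat (n choose k) * poly ?d (of_nat k))"
  proof -
    have "(\<Sum>k\<le>Suc n. (-1) ^ k * of_nat (Suc n choose k) * poly q (of_nat k)) =
      poly q 0 + (\<Sum>k\<le>n. (-1) ^ Suc k * of_nat (n choose Suc k) * poly q (of_nat (Suc k)))
        - (\<Sum>k\<le>n. (-1) ^ k * of_nat (n choose k) * poly q (of_nat (Suc k)))"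
      by (subst sum.atMost_Suc_shift)
        (simp add: algebra_simps sum.distrib sum_subtractf sum_negf)
    also have "poly q 0 + (\<Sum>k\<le>n. (-1) ^ Suc k * of_nat (n choose Suc k) * poly q (of_nat (Suc k)))
       = (\<Sum>k\<le>Suc n. (-1) ^ k * of_nat (n choose k) * poly q (of_nat k))"
      by (subst sum.atMost_Suc_shift) simp
    \<comment> \<open>The top term drops out because \<open>n choose Suc n\<close> is 0.\<close>
    also have "\<dots> = (\<Sum>k\<le>n. (-1) ^ k * of_nat (n choose k) * poly q (of_nat k))"
      by simp
    finally show ?thesis
      by (simp add: poly_pcompose algebra_simps sum_subtractf)
  qed
  also have "\<dots> = 0"
  \<comment> \<open>The degree can only drop if it is positive; for constant \<open>q\<close> the
    difference is already zero.\<close>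
  proof (cases "degree q = 0")
    case True
    then obtain c where "q = [:c:]" by (metis degree_eq_zeroE)
    then show ?thesis by simp
  next
    case False
    then show ?thesis using Suc.prems degree_diff_pcompose_shift[of q] by (intro Suc.IH) simp
  qed
  finally show ?case .
qed simp

section \<open>The power of a single factor modulo p^4\<close>

text \<open>A binomial expansion cut off after the cubic term. When \<open>x\<close> is a multiple
  of \<open>p\<close>, the remainder \<open>x ^ 4 * c\<close> is a multiple of
  \<open>p ^ 4\<close>.\<close>

lemma one_plus_power_expansion:
  assumes p: "prime p" and x: "x \<in> p_integral_rats p"
  shows "\<exists>c \<in> p_integral_rats p.
    (1 + x) ^ n = 1 + of_nat n * x + of_nat (n choose 2) * x ^ 2 + of_nat (n choose 3) * x ^ 3 + x ^ 4 * c"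
proof (induction n)
  case 0
  show ?case using p by (intro bexI[of _ 0]) (auto simp: binomial_eq_0)
next
  case (Suc n)
  then obtain c where c: "c \<in> p_integral_rats p"
    "(1 + x) ^ n = 1 + of_nat n * x + of_nat (n choose 2) * x ^ 2 + of_nat (n choose 3) * x ^ 3 + x ^ 4 * c"
    by blast
  have s: "Suc n choose 2 = n + (n choose 2)" "Suc n choose 3 = (n choose 2) + (n choose 3)"
    by (simp_all add: numeral_eq_Suc)
  \<comment> \<open>The new remainder collects the old cubic term times \<open>x\<close> and the old
    remainder times \<open>1 + x\<close>.\<close>
  have "(1 + x) ^ Suc n = 1 + of_nat (Suc n) * x + of_nat (Suc n choose 2) * x ^ 2
      + of_nat (Suc n choose 3) * x ^ 3 + x ^ 4 * (of_nat (n choose 3) + c + c * x)"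
    unfolding power_Suc c(2) s
    by (simp add: algebra_simps power2_eq_square power3_eq_cube power4_eq_xxxx)
  moreover have "of_nat (n choose 3) + c + c * x \<in> p_integral_rats p"
    using p x c(1) by (intro p_integral_intros)
  ultimately show ?case by (rule bexI)
qed

text \<open>The quadratic binomial term carries the whole correction \<open>p ^ 3 u\<^sup>2 / 2\<close>: the linear one is
  exactly \<open>- p u\<close>, and \<open>p\<close> divides the cubic coefficient.\<close>

lemma factor_cong:
  fixes p j :: nat
  assumes p: "prime p" "p > 3" and j: "0 < j" "j < p"
  defines "u \<equiv> 1 / of_nat j :: rat" and "t \<equiv> of_nat p / (of_nat p + 1) :: rat"
  shows "rat_cong p ((1 - t * u) ^ (p + 1)) ((1 - of_nat p * u) * (1 + of_nat p ^ 3 * (u ^ 2 / 2))) (p ^ 4)"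
proof -
  define v :: rat where "v = 1 / (of_nat p + 1)"
  let ?P = "of_nat p :: rat"
  have u: "u \<in> p_integral_rats p" unfolding u_def
    using p_integral_divide[OF p(1) p_integral_1[OF p(1)] coprime_small[OF p(1) j]] .
  have "coprime (p + 1) p" by simp
  then have v: "v \<in> p_integral_rats p" unfolding v_def
    using p_integral_divide[OF p(1) p_integral_1[OF p(1)], of "p + 1"] by (simp add: add.commute)
  have tv: "t = ?P * v" by (simp add: t_def v_def)
  have v1: "(?P + 1) * v = 1" unfolding v_def
    by (metis add.commute nonzero_mult_div_cancel_left of_nat_Suc of_nat_eq_0_iff old.nat.distinct(2)
        times_divide_eq_right mult.right_neutral)
  have "p > 2" using p(2) by simp
  note half = p_integral_half[OF p(1) this]
  have tu: "- (t * u) \<in> p_integral_rats p" unfolding tv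
    using p(1) u v by (intro p_integral_uminus p_integral_mult p_integral_of_nat)
  obtain c where c: "c \<in> p_integral_rats p"
    "(1 + - (t * u)) ^ (p + 1) = 1 + of_nat (p + 1) * - (t * u) + of_nat (p + 1 choose 2) * (- (t * u)) ^ 2
      + of_nat (p + 1 choose 3) * (- (t * u)) ^ 3 + (- (t * u)) ^ 4 * c"
    using one_plus_power_expansion[OF p(1) tu, of "p + 1"] by (rule bexE)
  have c2: "of_nat (p + 1 choose 2) = ?P * (?P + 1) / 2"
  proof -
    have "of_nat (2 * (p + 1 choose 2)) = (of_nat ((p + 1) * p) :: rat)"
      by (simp add: choose_two)
    then show ?thesis by (simp add: algebra_simps)
  qed
  \<comment> \<open>By Pascal's rule this is a sum of two inner binomial coefficients of row
    \<open>p\<close>; here \<open>p > 3\<close> enters.\<close>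
  have "p dvd (p + 1 choose 3)"
  proof -
    have "p dvd (p choose 2)" "p dvd (p choose 3)" using p by (auto intro!: dvd_choose_prime)
    moreover have "p + 1 choose 3 = (p choose 2) + (p choose 3)" by (simp add: numeral_eq_Suc)
    ultimately show ?thesis by simp
  qed
  then obtain m where m: "p + 1 choose 3 = p * m" by blast
  \<comment> \<open>The summands are, in order, the excess of the quadratic term over
    \<open>p ^ 3 * (u ^ 2 / 2)\<close>, the cubic term, the remainder, and the cross term of the
    product on the right, each divided by \<open>p ^ 4\<close>.\<close>
  define e where "e = (u ^ 2 / 2) * (- v) + - (of_nat m * (v * u) ^ 3) + (v * u) ^ 4 * c + u ^ 3 / 2"
  have e: "e \<in> p_integral_rats p"
    unfolding e_def using p(1) u v c(1)
    by (intro p_integral_intros half)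
  have l: "of_nat (p + 1) * - (t * u) = - (?P * u)"
  proof -
    have "of_nat (p + 1) * - (t * u) = - (((?P + 1) * v) * (?P * u))"
      unfolding tv by (simp add: algebra_simps)
    then show ?thesis unfolding v1 by simp
  qed
  have q: "?P * (?P + 1) / 2 * (- (t * u)) ^ 2 = ?P ^ 3 * (u ^ 2 / 2) * (1 - ?P * v)"
  proof -
    have "?P * (?P + 1) / 2 * (- (t * u)) ^ 2 = ?P ^ 3 * (u ^ 2 / 2) * (((?P + 1) * v) * v)"
      unfolding tv by (simp add: power2_eq_square power3_eq_cube)
    \<comment> \<open>Since \<open>(p + 1) * v = 1\<close>, the left side is \<open>v\<close>
      itself, and \<open>v = 1 - p * v\<close>.\<close>
    also have "((?P + 1) * v) * v = 1 - ?P * v"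
      unfolding v1 using v1 by (simp add: algebra_simps)
    finally show ?thesis .
  qed
  have "(1 - t * u) ^ (p + 1) = 1 + - (?P * u) + ?P ^ 3 * (u ^ 2 / 2) * (1 - ?P * v)
      + (?P * of_nat m) * (- (t * u)) ^ 3 + (- (t * u)) ^ 4 * c"
    using c(2) unfolding m c2 l q of_nat_mult by (simp only: add_uminus_conv_diff)
  moreover have "1 + - (?P * u) + ?P ^ 3 * (u ^ 2 / 2) * (1 - ?P * v)
      + (?P * of_nat m) * (- (t * u)) ^ 3 + (- (t * u)) ^ 4 * c
      - (1 - ?P * u) * (1 + ?P ^ 3 * (u ^ 2 / 2)) = of_nat (p ^ 4) * e"
    unfolding e_def tv of_nat_power
    by (simp add: field_simps power2_eq_square power3_eq_cube power4_eq_xxxx)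
  ultimately have "(1 - t * u) ^ (p + 1) - (1 - ?P * u) * (1 + ?P ^ 3 * (u ^ 2 / 2)) = of_nat (p ^ 4) * e"
    by (simp only:)
  moreover have "(1 - t * u) ^ (p + 1) \<in> p_integral_rats p" unfolding tv
    using p(1) u v by (intro p_integral_intros)
  moreover have "(1 - ?P * u) * (1 + ?P ^ 3 * (u ^ 2 / 2)) \<in> p_integral_rats p"
    using p(1) u by (intro p_integral_intros half)
  ultimately show ?thesis using e by (intro rat_congI)
qed

section \<open>Harmonic sums of order two and signed binomial coefficients\<close>

definition harmonic2 :: "nat \<Rightarrow> rat" where
  "harmonic2 k = (\<Sum>j = 1..k. (1 / of_nat j) ^ 2)"

lemma harmonic2_0 [simp]: "harmonic2 0 = 0"
  by (simp add: harmonic2_def)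

lemma harmonic2_Suc: "harmonic2 (Suc k) = harmonic2 k + (1 / of_nat (Suc k)) ^ 2"
  by (simp add: harmonic2_def)

lemma p_integral_harmonic2:
  assumes "prime p" "k < p" shows "harmonic2 k \<in> p_integral_rats p"
  unfolding harmonic2_def using assms
  by (intro p_integral_sum p_integral_power p_integral_divide coprime_small) auto

definition signed_binomial :: "nat \<Rightarrow> nat \<Rightarrow> rat" where
  "signed_binomial n k = (-1) ^ k * of_nat (n choose k)"

lemma signed_binomial_integral: "prime p \<Longrightarrow> signed_binomial n k \<in> p_integral_rats p"
  using p_integral_of_int[of p "(-1) ^ k * int (n choose k)"] by (simp add: signed_binomial_def)

text \<open>By absorption of binomial coefficients. Iterated, it shows that
  \<open>signed_binomial (p - 1) k\<close> is the product of the \<open>1 - p / j\<close> for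
  \<open>1 \<le> j \<le> k\<close>, the main parts in \<open>factor_cong\<close>.\<close>

lemma signed_binomial_Suc:
  assumes "Suc k < p"
  shows "signed_binomial (p - 1) (Suc k) = signed_binomial (p - 1) k * (1 - of_nat p * (1 / of_nat (Suc k)))"
proof -
  have "Suc k * (p - 1 choose Suc k) = (p - 1 - k) * (p - 1 choose k)"
    by (metis binomial_absorb_comp binomial_absorption mult.commute)
  then have "of_nat (Suc k) * of_nat (p - 1 choose Suc k) = (of_nat p - of_nat (Suc k)) * (of_nat (p - 1 choose k) :: rat)"
    using assms by (metis (no_types, lifting) diff_diff_left less_imp_le_nat of_nat_diff of_nat_mult plus_1_eq_Suc)
  then have *: "of_nat (p - 1 choose Suc k) = (of_nat p - of_nat (Suc k)) * (of_nat (p - 1 choose k) :: rat) / of_nat (Suc k)"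
    by (metis nonzero_mult_div_cancel_left of_nat_eq_0_iff old.nat.distinct(2))
  show ?thesis unfolding signed_binomial_def *
    by (simp add: field_simps del: of_nat_Suc)
qed

text \<open>Each factor \<open>1 - p / j\<close> of the product is 1 modulo
  \<open>p\<close>.\<close>

lemma signed_binomial_cong_1:
  assumes "prime p" "k < p"
  shows "rat_cong p (signed_binomial (p - 1) k) 1 p"
  using assms(2)
proof (induction k)
  case 0
  show ?case using assms(1) by (auto simp: signed_binomial_def)
next
  case (Suc k)
  let ?u = "1 / of_nat (Suc k) :: rat"
  have u: "?u \<in> p_integral_rats p"
    using assms(1) Suc.prems by (intro p_integral_divide coprime_small) auto
  have "1 - of_nat p * ?u - 1 = of_nat p * (- ?u)" by simp
  then have "rat_cong p (1 - of_nat p * ?u) 1 p"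
    by (rule rat_congI) (insert u assms(1), ((assumption | rule p_integral_intros)+))
  then have "rat_cong p (signed_binomial (p - 1) k * (1 - of_nat p * ?u)) (1 * 1) p"
    using Suc assms(1) by (intro rat_cong_mult) auto
  then show ?case unfolding signed_binomial_Suc[OF Suc.prems] mult_1_left .
qed

section \<open>The Pochhammer quotient modulo p^4\<close>

text \<open>Multiplying the congruences of \<open>factor_cong\<close> together, the main parts form
  the signed binomial coefficient and the corrections of order \<open>p ^ 3\<close> add up to the
  harmonic sum.\<close>

lemma pochhammer_power_cong:
  fixes p k :: nat
  assumes p: "prime p" "p > 3" and k: "k < p"
  shows "rat_cong p (pochhammer (1 / (of_nat p + 1)) k ^ (p + 1) / fact k ^ (p + 1))
    (signed_binomial (p - 1) k * (1 + of_nat p ^ 3 * (harmonic2 k / 2))) (p ^ 4)"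
  using k
proof (induction k)
  case 0
  show ?case using p by (auto simp: signed_binomial_def)
next
  case (Suc k)
  let ?P = "of_nat p :: rat" and ?u = "1 / of_nat (Suc k) :: rat"
  let ?B = "signed_binomial (p - 1)"
  have "p > 2" using p(2) by simp
  note half = p_integral_half[OF p(1) this]
  have u: "?u \<in> p_integral_rats p"
    using p(1) Suc.prems by (intro p_integral_divide coprime_small) auto
  have h: "harmonic2 k \<in> p_integral_rats p"
    using p(1) Suc.prems by (intro p_integral_harmonic2) auto
  have "?P + 1 \<noteq> 0" by (metis add.commute of_nat_Suc of_nat_eq_0_iff old.nat.distinct(2))
  then have f: "(1 / (?P + 1) + of_nat k) / of_nat (Suc k) = 1 - ?P / (?P + 1) * ?u"
    by (simp add: divide_simps del: of_nat_Suc) (simp add: algebra_simps)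
  have "pochhammer (1 / (?P + 1)) (Suc k) ^ (p + 1) / fact (Suc k) ^ (p + 1) =
      (pochhammer (1 / (?P + 1)) k ^ (p + 1) / fact k ^ (p + 1)) * (1 - ?P / (?P + 1) * ?u) ^ (p + 1)"
    unfolding f[symmetric] pochhammer_Suc fact_Suc power_mult_distrib power_divide
    by (simp add: mult.commute)
  then have "rat_cong p (pochhammer (1 / (?P + 1)) (Suc k) ^ (p + 1) / fact (Suc k) ^ (p + 1))
      ((?B k * (1 + ?P ^ 3 * (harmonic2 k / 2))) * ((1 - ?P * ?u) * (1 + ?P ^ 3 * (?u ^ 2 / 2)))) (p ^ 4)"
    using rat_cong_mult[OF p(1) Suc.IH factor_cong[OF p, of "Suc k"]] Suc.prems by simp
  moreover have "rat_cong p ((?B k * (1 + ?P ^ 3 * (harmonic2 k / 2))) * ((1 - ?P * ?u) * (1 + ?P ^ 3 * (?u ^ 2 / 2))))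
     (?B (Suc k) * (1 + ?P ^ 3 * (harmonic2 (Suc k) / 2))) (p ^ 4)"
  proof -
    \<comment> \<open>The product of the two corrections has order \<open>p ^ 6\<close>; taking out
      \<open>p ^ 4\<close> leaves \<open>p ^ 2\<close>.\<close>
    define e where "e = ?B (Suc k) * (?P ^ 2 * ((harmonic2 k / 2) * (?u ^ 2 / 2)))"
    have "(?B k * (1 + ?P ^ 3 * (harmonic2 k / 2))) * ((1 - ?P * ?u) * (1 + ?P ^ 3 * (?u ^ 2 / 2)))
      = (?B k * (1 - ?P * ?u)) * ((1 + ?P ^ 3 * (harmonic2 k / 2)) * (1 + ?P ^ 3 * (?u ^ 2 / 2)))"
      by (simp only: ac_simps)
    also have "\<dots> = ?B (Suc k) * (1 + ?P ^ 3 * (harmonic2 (Suc k) / 2)) + of_nat (p ^ 4) * e"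
      unfolding signed_binomial_Suc[OF Suc.prems, symmetric] e_def harmonic2_Suc
      by (simp add: algebra_simps power2_eq_square power3_eq_cube power4_eq_xxxx add_divide_distrib del: of_nat_Suc)
    finally have *: "(?B k * (1 + ?P ^ 3 * (harmonic2 k / 2))) * ((1 - ?P * ?u) * (1 + ?P ^ 3 * (?u ^ 2 / 2)))
      = ?B (Suc k) * (1 + ?P ^ 3 * (harmonic2 (Suc k) / 2)) + of_nat (p ^ 4) * e" .
    have e: "e \<in> p_integral_rats p" unfolding e_def using p(1) u h
      by (intro p_integral_intros half signed_binomial_integral)
    have i: "?B (Suc k) * (1 + ?P ^ 3 * (harmonic2 (Suc k) / 2)) \<in> p_integral_rats p"
      unfolding harmonic2_Suc using p(1) u h
      by (intro p_integral_intros half signed_binomial_integral)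
    have "of_nat (p ^ 4) * e \<in> p_integral_rats p"
      using p(1) e by (intro p_integral_intros)
    then show ?thesis unfolding * using p(1) e i
      by (intro rat_congI[OF _ e p_integral_add]) simp_all
  qed
  ultimately show ?case by (rule rat_cong_trans[OF p(1)])
qed

section \<open>Reflection of the index and the correction sum modulo p\<close>

text \<open>Passing from \<open>k\<close> to \<open>k + 1\<close> trades the summand at
  \<open>p - (k + 1)\<close> for the one at \<open>k + 1\<close>. These indices are negatives of
  each other modulo \<open>p\<close>, so their inverse squares agree.\<close>

lemma harmonic2_reflect:
  assumes p: "prime p" and k: "k < p"
  shows "rat_cong p (harmonic2 (p - 1 - k) + harmonic2 k) (harmonic2 (p - 1)) p"
  using k
proof (induction k)
  case 0
  show ?case using p p_integral_harmonic2[OF p, of "p - 1"] prime_gt_0_nat[OF p] by auto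
next
  case (Suc k)
  let ?a = "p - Suc k"
  have a: "p - 1 - k = ?a" "?a = Suc (p - 1 - Suc k)" "0 < ?a" "?a < p" using Suc.prems by auto
  have 1: "rat_cong p (1 / of_nat ?a) (- (1 / of_nat (Suc k))) p"
  proof -
    have i: "1 / of_nat ?a \<in> p_integral_rats p" "1 / of_nat (Suc k) \<in> p_integral_rats p"
      using p a Suc.prems by (auto intro!: p_integral_divide coprime_small simp del: of_nat_Suc)
    have "1 / of_nat ?a - (- (1 / of_nat (Suc k))) = of_nat p * ((1 / of_nat ?a) * (1 / of_nat (Suc k)) :: rat)"
      using Suc.prems by (simp add: of_nat_diff divide_simps del: of_nat_Suc)
    then show ?thesis by (rule rat_congI) (insert i p, ((assumption | rule p_integral_intros)+))
  qed
  from rat_cong_power[OF p this, of 2]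
  have 2: "rat_cong p ((1 / of_nat (Suc k)) ^ 2) ((1 / of_nat ?a) ^ 2) p"
    by (simp add: rat_cong_sym[OF p] del: of_nat_Suc)
  have h: "harmonic2 (p - 1 - Suc k) + harmonic2 k \<in> p_integral_rats p"
    using p Suc.prems by (intro p_integral_add p_integral_harmonic2) auto
  have "rat_cong p ((harmonic2 (p - 1 - Suc k) + harmonic2 k) + (1 / of_nat (Suc k)) ^ 2)
     ((harmonic2 (p - 1 - Suc k) + harmonic2 k) + (1 / of_nat ?a) ^ 2) p"
    by (rule rat_cong_add[OF p rat_cong_refl[OF p h] 2])
  moreover have "(harmonic2 (p - 1 - Suc k) + harmonic2 k) + (1 / of_nat ?a) ^ 2 = harmonic2 (p - 1 - k) + harmonic2 k"
    using harmonic2_Suc[of "p - 1 - Suc k"] unfolding a(1) a(2)[symmetric] by simp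
  ultimately have "rat_cong p (harmonic2 (p - 1 - Suc k) + harmonic2 (Suc k)) (harmonic2 (p - 1 - k) + harmonic2 k) p"
    by (simp only: harmonic2_Suc add.assoc)
  then show ?case using Suc by (intro rat_cong_trans[OF p _ Suc.IH]) auto
qed

text \<open>The alternating binomial sum of \<open>q\<close> vanishes exactly, and modulo
  \<open>p\<close> its coefficients may all be replaced by 1.\<close>

lemma sum_poly_cong_0:
  assumes p: "prime p" and q: "degree q < p - 1"
    and int: "\<And>k. poly q (of_nat k) \<in> p_integral_rats p"
  shows "rat_cong p (\<Sum>k<p. poly q (of_nat k)) 0 p"
proof -
  have "{..p - 1} = {..<p}" using prime_gt_0_nat[OF p] by auto
  then have z: "(\<Sum>k<p. signed_binomial (p - 1) k * poly q (of_nat k)) = 0"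
    using alternating_binomial_sum_poly[OF q] by (simp add: signed_binomial_def)
  have "rat_cong p (\<Sum>k<p. signed_binomial (p - 1) k * poly q (of_nat k)) (\<Sum>k<p. 1 * poly q (of_nat k)) p"
    using p int by (intro rat_cong_sum rat_cong_mult signed_binomial_cong_1 rat_cong_refl) auto
  then show ?thesis unfolding z using rat_cong_sym[OF p] by simp
qed

lemma weighted_harmonic2_sum_cong_0:
  fixes p r :: nat
  assumes p: "prime p" "p > 2 * r + 1" "p > 2"
  shows "rat_cong p (\<Sum>k<p. (of_nat k * (of_nat k + 1)) ^ r * harmonic2 k) 0 p"
proof -
  define w :: "nat \<Rightarrow> rat" where "w k = (of_nat k * (of_nat k + 1)) ^ r" for k
  define S where "S = (\<Sum>k<p. w k * harmonic2 k)"
  have wi: "w k \<in> p_integral_rats p" for k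
    unfolding w_def using p(1) by (intro p_integral_intros)
  have hi: "harmonic2 k \<in> p_integral_rats p" if "k < p" for k
    using p_integral_harmonic2[OF p(1) that] .
  have refl_w: "rat_cong p (w (p - 1 - k)) (w k) p" if "k < p" for k
  proof -
    \<comment> \<open>With \<open>m = p - 1 - k\<close> the difference is
      \<open>(m + k + 1) * (m - k)\<close>, and the first factor equals \<open>p\<close>.\<close>
    have "of_nat (p - 1 - k) * (of_nat (p - 1 - k) + 1) - of_nat k * (of_nat k + 1) =
        of_nat p * (of_nat p - 1 - 2 * of_nat k :: rat)"
      using that by (simp add: of_nat_diff algebra_simps)
    then have "rat_cong p (of_nat (p - 1 - k) * (of_nat (p - 1 - k) + 1)) (of_nat k * (of_nat k + 1)) p"
      by (rule rat_congI) (insert p(1), (assumption | rule p_integral_intros p_integral_numeral)+)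
    then show ?thesis unfolding w_def by (rule rat_cong_power[OF p(1)])
  qed
  have S: "S = (\<Sum>k<p. w (p - 1 - k) * harmonic2 (p - 1 - k))"
    unfolding S_def by (subst sum.nat_diff_reindex[symmetric]) simp
  \<comment> \<open>Only one copy of \<open>S\<close> is reversed, so that the harmonic sums at
    \<open>k\<close> and \<open>p - 1 - k\<close> meet under the same weight.\<close>
  have "rat_cong p (S + S) (\<Sum>k<p. w k * harmonic2 (p - 1 - k) + w k * harmonic2 k) p"
    unfolding sum.distrib S_def[symmetric]
    by (subst (1) S)
      (intro rat_cong_add rat_cong_sum rat_cong_mult refl_w rat_cong_refl,
        auto simp: S_def intro!: p(1) wi hi p_integral_sum p_integral_mult)
  moreover have "rat_cong p (\<Sum>k<p. w k * (harmonic2 (p - 1 - k) + harmonic2 k)) (\<Sum>k<p. w k * harmonic2 (p - 1)) p"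
    using p(1) wi by (intro rat_cong_sum rat_cong_mult harmonic2_reflect rat_cong_refl) auto
  moreover have "rat_cong p (\<Sum>k<p. w k * harmonic2 (p - 1)) 0 p"
  proof -
    let ?q = "([:0, 1:] * [:1, 1:]) ^ r :: rat poly"
    have pq: "poly ?q (of_nat k) = w k" for k
      unfolding w_def by (simp add: algebra_simps)
    have "degree ?q \<le> degree ([:0, 1:] * [:1, 1:] :: rat poly) * r" by (rule degree_power_le)
    also have "\<dots> = 2 * r" by simp
    finally have "degree ?q < p - 1" using p by simp
    then have "rat_cong p (\<Sum>k<p. w k) 0 p"
      using sum_poly_cong_0[OF p(1), of ?q] wi unfolding pq by blast
    then have "rat_cong p ((\<Sum>k<p. w k) * harmonic2 (p - 1)) (0 * harmonic2 (p - 1)) p"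
      using p by (intro rat_cong_mult rat_cong_refl hi) auto
    then show ?thesis by (simp add: sum_distrib_right)
  qed
  ultimately have "rat_cong p (S + S) 0 p"
    unfolding ring_distribs by (meson rat_cong_trans[OF p(1)])
  \<comment> \<open>\<open>S\<close> was doubled, and 2 is invertible because
    \<open>p > 2\<close>.\<close>
  moreover have "1 / 2 \<in> p_integral_rats p"
    using p by (intro p_integral_half p_integral_1)
  ultimately have "rat_cong p (1 / 2 * (S + S)) (1 / 2 * 0) p"
    using p(1) by (intro rat_cong_mult rat_cong_refl)
  then show ?thesis by (simp add: S_def w_def)
qed

section \<open>Main part and correction combined\<close>

theorem theorem1p2:
  fixes r p :: nat
  assumes "r > 0" and "prime p" and "p > 2 * r + 1"
  shows "rat_cong p
    (\<Sum>k = 0..p - 1. of_nat k ^ r * (of_nat k + 1 / (of_nat p + 1)) ^ r *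
        (pochhammer (1 / (of_nat p + 1)) k ^ (p + 1) / fact k ^ (p + 1)))
    0 (p ^ 4)"
proof -
  note p = assms(2)
  \<comment> \<open>As \<open>r\<close> is positive, \<open>2 * r + 1\<close> is at least 3.\<close>
  have p3: "p > 3" using assms by simp
  let ?P = "of_nat p :: rat"
  let ?B = "signed_binomial (p - 1)"
  define v where "v = 1 / (?P + 1)"
  \<comment> \<open>The weight as a polynomial in \<open>k\<close>. Its degree is at most
    \<open>2 * r\<close>, hence below \<open>p - 1\<close> by the bound on \<open>p\<close>.\<close>
  define q where "q = ([:0, 1:] * [:v, 1:]) ^ r"
  have v: "v \<in> p_integral_rats p" unfolding v_def
    using p_integral_divide[OF p p_integral_1[OF p], of "p + 1"] by (simp add: add.commute)
  have pq: "poly q (of_nat k) = (of_nat k * (of_nat k + v)) ^ r" for k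
    unfolding q_def by (simp add: algebra_simps)
  have qi: "poly q (of_nat k) \<in> p_integral_rats p" for k
    unfolding pq using p v by (intro p_integral_intros)
  have "degree q \<le> degree ([:0, 1:] * [:v, 1:]) * r" unfolding q_def by (rule degree_power_le)
  also have "\<dots> = 2 * r" by simp
  finally have dq: "degree q < p - 1" using assms by simp
  have sets: "{0..p - 1} = {..<p}" "{..p - 1} = {..<p}" using prime_gt_0_nat[OF p] by auto
  have z: "(\<Sum>k<p. ?B k * poly q (of_nat k)) = 0"
    using alternating_binomial_sum_poly[OF dq] unfolding sets signed_binomial_def .
  have half: "1 / 2 \<in> p_integral_rats p"
    using p p3 by (intro p_integral_half p_integral_1) auto
  let ?T = "\<Sum>k<p. poly q (of_nat k) * (?B k * harmonic2 k)"
  have "rat_cong p (\<Sum>k<p. poly q (of_nat k) * (pochhammer v k ^ (p + 1) / fact k ^ (p + 1)))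
     (\<Sum>k<p. poly q (of_nat k) * (?B k * (1 + ?P ^ 3 * (harmonic2 k / 2)))) (p ^ 4)"
    using p p3 qi unfolding v_def
    by (intro rat_cong_sum rat_cong_mult rat_cong_refl pochhammer_power_cong) auto
  also have "(\<Sum>k<p. poly q (of_nat k) * (?B k * (1 + ?P ^ 3 * (harmonic2 k / 2)))) =
      (\<Sum>k<p. ?B k * poly q (of_nat k)) + of_nat (p ^ 3) * (1 / 2 * ?T)"
    by (simp add: algebra_simps sum.distrib sum_distrib_left sum_divide_distrib)
  finally have 1: "rat_cong p (\<Sum>k<p. poly q (of_nat k) * (pochhammer v k ^ (p + 1) / fact k ^ (p + 1)))
      (of_nat (p ^ 3) * (1 / 2 * ?T)) (p ^ 4)" unfolding z by simp
  \<comment> \<open>With \<open>p ^ 3\<close> split off, the rest matters only modulo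
    \<open>p\<close>, where \<open>v\<close> becomes 1 and the weight becomes symmetric under
    reflection.\<close>
  have "rat_cong p v 1 p"
  proof -
    have "?P + 1 \<noteq> 0" by (metis add.commute of_nat_Suc of_nat_eq_0_iff old.nat.distinct(2))
    then have "v - 1 = ?P * (- v)" unfolding v_def by (simp add: field_simps)
    then show ?thesis by (rule rat_congI) (insert v p, ((assumption | rule p_integral_intros)+))
  qed
  then have "rat_cong p ?T (\<Sum>k<p. (of_nat k * (of_nat k + 1)) ^ r * (1 * harmonic2 k)) p"
    unfolding pq using p
    by (intro rat_cong_sum rat_cong_mult rat_cong_power rat_cong_add rat_cong_refl
        signed_binomial_cong_1 p_integral_harmonic2) auto
  moreover have "rat_cong p (\<Sum>k<p. (of_nat k * (of_nat k + 1)) ^ r * (1 * harmonic2 k)) 0 p"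
    using weighted_harmonic2_sum_cong_0[OF p, of r] assms p3 by simp
  ultimately have "rat_cong p ?T 0 p" by (rule rat_cong_trans[OF p])
  then have "rat_cong p (1 / 2 * ?T) (1 / 2 * 0) p"
    using p half by (intro rat_cong_mult rat_cong_refl)
  from rat_cong_scale[OF p this, of "p ^ 3"]
  have "rat_cong p (of_nat (p ^ 3) * (1 / 2 * ?T)) 0 (p ^ 4)"
    by (simp add: power_numeral_reduce mult.commute)
  with 1 have "rat_cong p (\<Sum>k<p. poly q (of_nat k) * (pochhammer v k ^ (p + 1) / fact k ^ (p + 1))) 0 (p ^ 4)"
    by (rule rat_cong_trans[OF p])
  then show ?thesis unfolding pq sets v_def by (simp add: power_mult_distrib)
qed

end
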